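(* Let $\mathbb F$ be a field, let $k_1>k_2>\dots>k_t>0$ and $p_1,\dots,p_t\ge 1$ be integers, and let $J$ be the nilpotent Jordan matrix over $\mathbb F$ that is the direct sum of $p_s$ copies of $J_{k_s}(0)$ for $s=1,\dots,t$. Let $k:=k_1$ and let $W$ be the Weyr canonical form of $J$. Then the set of matrices over $\mathbb F$ that commute with $W$ consists of all block upper triangular matrices of the form $$ S=\begin{bmatrix}\underline S_{11}&\underline S_{12}&\cdots&\underline S_{1k}\\ &\underline S_{22}&\ddots&\vdots\\ &&\ddots&\underline S_{k-1,k}\\ 0&&&\underline S_{kk}\end{bmatrix},\qquad \underline S_{\alpha\beta}=\begin{bmatrix}S_{11}^{(\beta-\alpha)}&\cdots&S_{1m_\beta}^{(\beta-\alpha)}\\ \vdots&&\vdots\\ S_{m_\alpha1}^{(\beta-\alpha)}&\cdots&S_{m_\alpha m_\beta}^{(\beta-\alpha)}\end{bmatrix}\quad(1\le\alpha\le\beta\le k), $$ in which every $S_{ij}^{(\gamma)}$ is a $p_i\times p_j$ matrix over $\mathbb F$ (depending only on $i$, $j$ and $\gamma$, so that the same matrix $S_{ij}^{(\gamma)}$ occurs in every $\underline S_{\alpha\beta}$ with $\beta-\alpha=\gamma$, $i\le m_\alpha$, $j\le m_\beta$) such that $$ S_{ij}^{(\gamma)}\text{ is arbitrary if }k_j-k_i\le\gamma,\qquad S_{ij}^{(\gamma)}=0\text{ if }k_j-k_i>\gamma. $$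
   Context: $J_m(0)$ is the $m\times m$ nilpotent Jordan block with ones on the first superdiagonal and zeros elsewhere. For $1\le\alpha\le k=k_1$, $m_\alpha$ denotes the number of distinct sizes of Jordan blocks of $J$ among those of size at least $\alpha\times\alpha$, i.e. the number of $s\in\{1,\dots,t\}$ with $k_s\ge\alpha$; and $r_\alpha$ denotes the number of Jordan blocks of $J$ of size at least $\alpha\times\alpha$, so $r_\alpha=p_1+\dots+p_{m_\alpha}$. The Weyr canonical form $W$ of $J$ is the $k\times k$ block matrix whose $(\alpha,\beta)$ block has size $r_\alpha\times r_\beta$, whose $(\alpha,\alpha+1)$ block is $\begin{bmatrix}I_{r_{\alpha+1}}\\0\end{bmatrix}$ for $\alpha=1,\dots,k-1$ (identity matrix on top of zero rows), and all of whose other blocks are zero. The matrix $S$ is partitioned conformally with $W$, so $\underline S_{\alpha\beta}$ has size $r_\alpha\times r_\beta$. *)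

theory Defs
  imports "Jordan_Normal_Form.Jordan_Normal_Form"
begin

(* Partitioned matrices with block rows 1..M and block columns 1..N. The block B a b is meant
   to have size r a x c b. An index i is decoded as (block number, offset inside the block). *)

definition block_num :: "(nat \<Rightarrow> nat) \<Rightarrow> nat \<Rightarrow> nat" where
  "block_num r i = (LEAST a. i < (\<Sum>a'\<in>{1..a}. r a'))"

definition block_off :: "(nat \<Rightarrow> nat) \<Rightarrow> nat \<Rightarrow> nat" where
  "block_off r i = i - (\<Sum>a'\<in>{1..<block_num r i}. r a')"

definition partitioned_mat ::
  "nat \<Rightarrow> nat \<Rightarrow> (nat \<Rightarrow> nat) \<Rightarrow> (nat \<Rightarrow> nat) \<Rightarrow> (nat \<Rightarrow> nat \<Rightarrow> 'a mat) \<Rightarrow> 'a mat" where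
  "partitioned_mat M N r c B =
     mat (\<Sum>a\<in>{1..M}. r a) (\<Sum>b\<in>{1..N}. c b)
       (\<lambda>(i, j). B (block_num r i) (block_num c j) $$ (block_off r i, block_off c j))"

lemma block_num_eq:
  assumes "1 \<le> a" "x < r a"
  shows "block_num r ((\<Sum>a'\<in>{1..<a}. r a') + x) = a"
  unfolding block_num_def
proof (rule Least_equality)
  have "{1..a} = insert a {1..<a}" using assms(1) by auto
  then show "(\<Sum>a'\<in>{1..<a}. r a') + x < (\<Sum>a'\<in>{1..a}. r a')"
    using assms(2) by simp
next
  fix y assume y: "(\<Sum>a'\<in>{1..<a}. r a') + x < (\<Sum>a'\<in>{1..y}. r a')"
  show "a \<le> y"
  proof (rule ccontr)
    assume "\<not> a \<le> y"
    then have "(\<Sum>a'\<in>{1..y}. r a') \<le> (\<Sum>a'\<in>{1..<a}. r a')"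
      by (intro sum_mono2) auto
    with y show False by simp
  qed
qed

lemma partitioned_mat_index:
  assumes "1 \<le> a" "a \<le> M" "x < r a" and "1 \<le> b" "b \<le> N" "y < c b"
  shows "partitioned_mat M N r c B $$
           ((\<Sum>a'\<in>{1..<a}. r a') + x, (\<Sum>b'\<in>{1..<b}. c b') + y) = B a b $$ (x, y)"
proof -
  have bound: "(\<Sum>a'\<in>{1..<a}. f a') + x < (\<Sum>a'\<in>{1..K}. f a')"
    if "1 \<le> a" "a \<le> K" "x < f a" for f :: "nat \<Rightarrow> nat" and a K x
  proof -
    have "{1..a} = insert a {1..<a}" using that(1) by auto
    then have "(\<Sum>a'\<in>{1..<a}. f a') + x < (\<Sum>a'\<in>{1..a}. f a')" using that(3) by simp
    also have "\<dots> \<le> (\<Sum>a'\<in>{1..K}. f a')" using that(2) by (intro sum_mono2) auto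
    finally show ?thesis .
  qed
  show ?thesis
    using bound[of a M x r] bound[of b N y c] block_num_eq[of a x r] block_num_eq[of b y c] assms
    by (simp add: partitioned_mat_def block_off_def)
qed

(* The list of (size, eigenvalue) pairs of the diagonal blocks of a Jordan matrix; empty blocks
   are excluded, which makes the list unique (see jordan_blocks_jordan_matrix). *)
definition jordan_blocks :: "'a::field mat \<Rightarrow> (nat \<times> 'a) list" where
  "jordan_blocks J = (THE n_as. J = jordan_matrix n_as \<and> 0 \<notin> fst ` set n_as)"

lemma jordan_matrix_Cons_index:
  fixes n_as :: "(nat \<times> 'a::field) list"
  assumes "i < n + sum_list (map fst n_as)" "j < n + sum_list (map fst n_as)"
  shows "jordan_matrix ((n, a) # n_as) $$ (i, j) =
    (if i < n then if j < n then if i = j then a else if Suc i = j then 1 else 0 else 0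
     else if j < n then 0 else jordan_matrix n_as $$ (i - n, j - n))"
proof -
  have "jordan_matrix ((n, a) # n_as) = four_block_mat (jordan_block n a)
      (0\<^sub>m n (sum_list (map fst n_as))) (0\<^sub>m (sum_list (map fst n_as)) n) (jordan_matrix n_as)"
    by (simp add: jordan_matrix_def[of "_ # _"] Let_def jordan_matrix_def[symmetric])
  then show ?thesis using assms by auto
qed

lemma jordan_matrix_inj:
  fixes xs ys :: "(nat \<times> 'a::field) list"
  assumes "jordan_matrix xs = jordan_matrix ys" "0 \<notin> fst ` set xs" "0 \<notin> fst ` set ys"
  shows "xs = ys"
  using assms
proof (induction xs arbitrary: ys)
  case Nil
  have "sum_list (map fst ys) = 0"
    using arg_cong[OF Nil(1), of dim_row] by simp
  with Nil(3) show ?case by (cases ys) auto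
next
  case (Cons na xs)
  obtain n a where na: "na = (n, a)" by force
  let ?sx = "sum_list (map fst xs)"
  have n0: "n > 0" using Cons.prems(2) na by auto
  have dim: "n + ?sx = sum_list (map fst ys)"
    using arg_cong[OF Cons.prems(1), of dim_row] na by simp
  with n0 obtain m b zs where ys: "ys = (m, b) # zs" by (cases ys) auto
  let ?sz = "sum_list (map fst zs)"
  have m0: "m > 0" using Cons.prems(3) ys by auto
  have dim': "n + ?sx = m + ?sz" using dim ys by simp
  have eq: "jordan_matrix ((n, a) # xs) $$ (i, j) = jordan_matrix ((m, b) # zs) $$ (i, j)" for i j
    using Cons.prems(1) na ys by simp
  have a: "a = b"
    using eq[of 0 0] n0 m0 dim' by (simp add: jordan_matrix_Cons_index)
  have "\<not> n < m"
  proof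
    assume "n < m"
    moreover obtain q where "n = Suc q" using n0 by (cases n) auto
    ultimately show False
      using eq[of q n] dim' by (simp add: jordan_matrix_Cons_index)
  qed
  moreover have "\<not> m < n"
  proof
    assume "m < n"
    moreover obtain q where "m = Suc q" using m0 by (cases m) auto
    ultimately show False
      using eq[of q m] dim' by (simp add: jordan_matrix_Cons_index)
  qed
  ultimately have n: "n = m" by simp
  then have sz: "?sx = ?sz" using dim' by simp
  have "jordan_matrix xs = jordan_matrix zs"
  proof (rule eq_matI)
    fix i j assume "i < dim_row (jordan_matrix zs)" "j < dim_col (jordan_matrix zs)"
    then show "jordan_matrix xs $$ (i, j) = jordan_matrix zs $$ (i, j)"
      using eq[of "n + i" "n + j"] n sz by (simp add: jordan_matrix_Cons_index)
  qed (use sz in auto)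
  then have "xs = zs" using Cons.IH Cons.prems(2,3) na ys by auto
  with na ys a n show ?case by simp
qed

lemma jordan_blocks_jordan_matrix:
  assumes "0 \<notin> fst ` set n_as"
  shows "jordan_blocks (jordan_matrix n_as) = n_as"
  unfolding jordan_blocks_def
proof (rule the_equality)
  show "jordan_matrix n_as = jordan_matrix n_as \<and> 0 \<notin> fst ` set n_as" using assms by simp
next
  fix xs assume "jordan_matrix n_as = jordan_matrix xs \<and> 0 \<notin> fst ` set xs"
  then show "xs = n_as" using jordan_matrix_inj[of n_as xs] assms by simp
qed

definition num_blocks_ge :: "'a::field mat \<Rightarrow> nat \<Rightarrow> nat" where
  "num_blocks_ge J \<alpha> = length (filter (\<lambda>(n, a). \<alpha> \<le> n) (jordan_blocks J))"

definition num_sizes_ge :: "'a::field mat \<Rightarrow> nat \<Rightarrow> nat" where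
  "num_sizes_ge J \<alpha> = card {n \<in> fst ` set (jordan_blocks J). \<alpha> \<le> n}"

(* The Weyr form of a (nonempty) nilpotent Jordan matrix; @r stacks its arguments vertically. *)
definition weyr_form :: "'a::field mat \<Rightarrow> 'a mat" where
  "weyr_form J =
     (let k = Max (fst ` set (jordan_blocks J)); r = num_blocks_ge J
      in partitioned_mat k k r r
           (\<lambda>\<alpha> \<beta>. if \<beta> = \<alpha> + 1 then 1\<^sub>m (r \<beta>) @\<^sub>r 0\<^sub>m (r \<alpha> - r \<beta>) (r \<beta>)
                  else 0\<^sub>m (r \<alpha>) (r \<beta>)))"

end

theory Submission
  imports Defs
begin

text \<open>The Weyr form \<open>W\<close> is a permuted \<open>J\<close>: row \<open>x\<close> of the block row \<open>\<alpha>\<close> is position \<open>\<alpha>\<close> of the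
  \<open>x\<close>-th Jordan chain, whose length is \<open>h x\<close>, and \<open>W\<close> moves it to position \<open>\<alpha> + 1\<close>. Hence
  \<open>A\<close> commutes with \<open>W\<close> iff, for each pair of chains \<open>x\<close>, \<open>y\<close>, the entries \<open>a \<alpha> \<beta>\<close> of \<open>A\<close> between
  positions \<open>\<alpha>\<close> and \<open>\<beta>\<close> intertwine two nilpotent Jordan blocks. Such an intertwiner is upper
  triangular and Toeplitz, with its first \<open>h y - h x\<close> diagonals equal to zero.\<close>

declare One_nat_def [simp del]

section \<open>Intertwiners of two nilpotent Jordan blocks\<close>

text \<open>The left side is the intertwining equation written entrywise. It makes \<open>a\<close>
  constant along diagonals: a diagonal that starts below the corner is fed by the 0 left of column
  1, and one that leaves through row \<open>h\<close> before column \<open>h'\<close> is killed by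
  the 0 below row \<open>h\<close>.\<close>

lemma jordan_block_intertwiner:
  fixes a :: "nat \<Rightarrow> nat \<Rightarrow> 'a::zero"
  assumes "1 \<le> h"
  shows "(\<forall>\<alpha>\<in>{1..h}. \<forall>\<beta>\<in>{1..h'}.
      (if 2 \<le> \<beta> then a \<alpha> (\<beta> - 1) else 0) = (if \<alpha> < h then a (\<alpha> + 1) \<beta> else 0)) \<longleftrightarrow>
    (\<forall>\<alpha>\<in>{1..h}. \<forall>\<beta>\<in>{1..h'}. a \<alpha> \<beta> = (if \<alpha> \<le> \<beta> then a 1 (\<beta> - \<alpha> + 1) else 0)) \<and>
    (\<forall>\<gamma>. h + \<gamma> < h' \<longrightarrow> a 1 (\<gamma> + 1) = 0)" (is "?L \<longleftrightarrow> ?T \<and> ?Z")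
proof
  assume L: ?L
  \<comment> \<open>Induction on the row, shifted by one so that the base case is row 1; the
    equation in row \<open>\<alpha> + 1\<close> leads one step down its diagonal.\<close>
  have T: "a (\<alpha> + 1) \<beta> = (if \<alpha> + 1 \<le> \<beta> then a 1 (\<beta> - (\<alpha> + 1) + 1) else 0)"
    if "\<alpha> + 1 \<le> h" "\<beta> \<in> {1..h'}" for \<alpha> \<beta>
    using that
  proof (induction \<alpha> arbitrary: \<beta>)
    case 0
    then show ?case by auto
  next
    case (Suc \<alpha>)
    then have "a (Suc \<alpha> + 1) \<beta> = (if 2 \<le> \<beta> then a (\<alpha> + 1) (\<beta> - 1) else 0)"
      using bspec[OF bspec[OF L, of "\<alpha> + 1"], of \<beta>] by (auto simp: Suc_eq_plus1)
    also have "\<dots> = (if Suc \<alpha> + 1 \<le> \<beta> then a 1 (\<beta> - (Suc \<alpha> + 1) + 1) else 0)"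
    proof (cases "2 \<le> \<beta>")
      case True
      then have "a (\<alpha> + 1) (\<beta> - 1) =
          (if \<alpha> + 1 \<le> \<beta> - 1 then a 1 (\<beta> - 1 - (\<alpha> + 1) + 1) else 0)"
        using Suc.prems by (intro Suc.IH) auto
      with True show ?thesis
        by (cases "Suc \<alpha> + 1 \<le> \<beta>") (auto simp: One_nat_def)
    qed simp
    finally show ?case .
  qed
  have ?T
  proof (intro ballI)
    fix \<alpha> \<beta> assume "\<alpha> \<in> {1..h}" "\<beta> \<in> {1..h'}"
    then show "a \<alpha> \<beta> = (if \<alpha> \<le> \<beta> then a 1 (\<beta> - \<alpha> + 1) else 0)"
      using T[of "\<alpha> - 1" \<beta>] by simp
  qed
  moreover have ?Z
  proof (intro allI impI)
    fix \<gamma> assume "h + \<gamma> < h'"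
    \<comment> \<open>The equation at row \<open>h\<close>, column \<open>h + \<gamma> + 1\<close>
      says \<open>a h (h + \<gamma>) = 0\<close>, and this entry lies on the diagonal of
      \<open>a 1 (\<gamma> + 1)\<close>.\<close>
    with assms T[of "h - 1" "h + \<gamma>"] bspec[OF bspec[OF L, of h], of "h + \<gamma> + 1"]
    show "a 1 (\<gamma> + 1) = 0" by auto
  qed
  ultimately show "?T \<and> ?Z" ..
next
  assume R: "?T \<and> ?Z"
  then have T: "a \<alpha> \<beta> = (if \<alpha> \<le> \<beta> then a 1 (\<beta> - \<alpha> + 1) else 0)"
    if "\<alpha> \<in> {1..h}" "\<beta> \<in> {1..h'}" for \<alpha> \<beta> using that by blast
  show ?L
  proof (intro ballI)
    fix \<alpha> \<beta> assume ab: "\<alpha> \<in> {1..h}" "\<beta> \<in> {1..h'}"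
    show "(if 2 \<le> \<beta> then a \<alpha> (\<beta> - 1) else 0) = (if \<alpha> < h then a (\<alpha> + 1) \<beta> else 0)"
    proof (cases "\<alpha> < h")
      case True
      then have "a (\<alpha> + 1) \<beta> = (if \<alpha> + 1 \<le> \<beta> then a 1 (\<beta> - (\<alpha> + 1) + 1) else 0)"
        using ab by (intro T) auto
      moreover have "a \<alpha> (\<beta> - 1) = (if \<alpha> \<le> \<beta> - 1 then a 1 (\<beta> - 1 - \<alpha> + 1) else 0)"
        if "2 \<le> \<beta>"
        using ab that by (intro T) auto
      ultimately show ?thesis using True ab
        by (cases "2 \<le> \<beta>"; cases "\<alpha> + 1 \<le> \<beta>") auto
    next
      case False
      with ab have "\<alpha> = h" by simp
      have "a h (\<beta> - 1) = 0" if "2 \<le> \<beta>"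
      proof -
        have "a h (\<beta> - 1) = (if h \<le> \<beta> - 1 then a 1 (\<beta> - 1 - h + 1) else 0)"
          using ab assms that by (intro T) auto
        \<comment> \<open>The diagonal is \<open>\<gamma> = \<beta> - 1 - h\<close>, for which
          \<open>h + \<gamma> = \<beta> - 1 < h'\<close>.\<close>
        moreover have "a 1 (\<beta> - 1 - h + 1) = 0" if "h \<le> \<beta> - 1"
          using R ab that \<open>2 \<le> \<beta>\<close> by (elim conjE allE[of _ "\<beta> - 1 - h"]) simp
        ultimately show ?thesis by simp
      qed
      with \<open>\<alpha> = h\<close> show ?thesis by simp
    qed
  qed
qed

section \<open>Index arithmetic of partitioned matrices\<close>

text \<open>The inverse of the decoding by \<open>block_num\<close> and \<open>block_off\<close>:
  blocks count from 1, offsets from 0. For the Weyr partition, \<open>a\<close> is a position and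
  \<open>x\<close> a chain.\<close>

definition block_idx :: "(nat \<Rightarrow> nat) \<Rightarrow> nat \<Rightarrow> nat \<Rightarrow> nat" where
  "block_idx r a x = (\<Sum>a'\<in>{1..<a}. r a') + x"

lemma block_num_idx [simp]: "1 \<le> a \<Longrightarrow> x < r a \<Longrightarrow> block_num r (block_idx r a x) = a"
  unfolding block_idx_def by (rule block_num_eq)

lemma block_off_idx [simp]: "1 \<le> a \<Longrightarrow> x < r a \<Longrightarrow> block_off r (block_idx r a x) = x"
  using block_num_eq[of a x r] by (simp add: block_off_def block_idx_def)

lemma block_idx_less:
  assumes "1 \<le> a" "a \<le> N" "x < r a"
  shows "block_idx r a x < sum r {1..N}"
proof -
  have "{1..a} = insert a {1..<a}" using assms(1) by auto
  then have "block_idx r a x < sum r {1..a}" using assms(3) by (simp add: block_idx_def)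
  also have "\<dots> \<le> sum r {1..N}" using assms(2) by (intro sum_mono2) auto
  finally show ?thesis .
qed

lemma block_idx_cases:
  assumes "i < sum r {1..N}"
  obtains a x where "1 \<le> a" "a \<le> N" "x < r a" "i = block_idx r a x"
  using assms
proof (induction N arbitrary: thesis)
  case 0
  then show ?case by simp
next
  case (Suc N)
  show ?case
  proof (cases "i < sum r {1..N}")
    case True
    with Suc show ?thesis by (metis le_SucI)
  next
    case False
    with Suc.prems(2) show ?thesis
      by (intro Suc.prems(1)[of "Suc N" "i - sum r {1..N}"])
        (auto simp: block_idx_def atLeastLessThanSuc_atLeastAtMost)
  qed
qed

lemma block_idx_num_off: "i < sum r {1..N} \<Longrightarrow> block_idx r (block_num r i) (block_off r i) = i"
  by (erule block_idx_cases) simp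

lemma block_off_less: "i < sum r {1..N} \<Longrightarrow> block_off r i < r (block_num r i)"
  by (erule block_idx_cases) simp

lemma block_num_ge_1: "i < sum r {1..N} \<Longrightarrow> 1 \<le> block_num r i"
  by (erule block_idx_cases) simp

text \<open>The first \<open>M\<close> blocks occupy an initial segment of the indices. For the
  partition by \<open>p\<close> this will turn a group number at most \<open>m \<alpha>\<close> into
  \<open>x < r \<alpha>\<close>.\<close>

lemma block_num_le_iff:
  assumes "i < sum r {1..N}"
  shows "block_num r i \<le> M \<longleftrightarrow> i < sum r {1..M}"
proof
  assume "block_num r i \<le> M"
  with block_idx_less[of "block_num r i" M "block_off r i" r]
  show "i < sum r {1..M}"
    using block_num_ge_1[OF assms] block_off_less[OF assms] block_idx_num_off[OF assms] by simp
qed (erule block_idx_cases, simp)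

lemma partitioned_mat_block_idx [simp]:
  assumes "1 \<le> a" "a \<le> M" "x < r a" "1 \<le> b" "b \<le> N" "y < c b"
  shows "partitioned_mat M N r c B $$ (block_idx r a x, block_idx c b y) = B a b $$ (x, y)"
  unfolding block_idx_def using assms by (rule partitioned_mat_index)

lemma partitioned_mat_carrier [simp]:
  "partitioned_mat M N r c B \<in> carrier_mat (sum r {1..M}) (sum c {1..N})"
  by (simp add: partitioned_mat_def)

lemma eq_mat_block_iff:
  assumes "A \<in> carrier_mat (sum r {1..M}) (sum c {1..N})"
    and "B \<in> carrier_mat (sum r {1..M}) (sum c {1..N})"
  shows "A = B \<longleftrightarrow> (\<forall>a\<in>{1..M}. \<forall>b\<in>{1..N}. \<forall>x<r a. \<forall>y<c b.
    A $$ (block_idx r a x, block_idx c b y) = B $$ (block_idx r a x, block_idx c b y))"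
    (is "_ \<longleftrightarrow> ?R")
proof
  assume R: ?R
  show "A = B"
  proof (rule eq_matI)
    fix i j assume "i < dim_row B" "j < dim_col B"
    with assms(2) have "i < sum r {1..M}" "j < sum c {1..N}" by auto
    with R show "A $$ (i, j) = B $$ (i, j)"
      by (elim block_idx_cases) auto
  qed (use assms in auto)
qed simp

section \<open>Multiplication by the Weyr matrix\<close>

text \<open>The body of \<open>weyr_form\<close> with the number and the sizes of the blocks
  abstracted from the Jordan matrix.\<close>

definition weyr_mat :: "nat \<Rightarrow> (nat \<Rightarrow> nat) \<Rightarrow> 'a::{zero,one} mat" where
  "weyr_mat K r = partitioned_mat K K r r
     (\<lambda>\<alpha> \<beta>. if \<beta> = \<alpha> + 1 then 1\<^sub>m (r \<beta>) @\<^sub>r 0\<^sub>m (r \<alpha> - r \<beta>) (r \<beta>) else 0\<^sub>m (r \<alpha>) (r \<beta>))"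

lemma weyr_mat_carrier [simp]: "weyr_mat K r \<in> carrier_mat (sum r {1..K}) (sum r {1..K})"
  by (simp add: weyr_mat_def)

lemma weyr_mat_dim [simp]:
  "dim_row (weyr_mat K r) = sum r {1..K}" "dim_col (weyr_mat K r) = sum r {1..K}"
  using weyr_mat_carrier[of K r] by (auto simp del: weyr_mat_carrier)

lemma weyr_mat_block_idx:
  assumes "r (\<alpha> + 1) \<le> r \<alpha>"
    and "1 \<le> \<alpha>" "\<alpha> \<le> K" "x < r \<alpha>" "1 \<le> \<beta>" "\<beta> \<le> K" "y < r \<beta>"
  shows "weyr_mat K r $$ (block_idx r \<alpha> x, block_idx r \<beta> y) =
    (if \<beta> = \<alpha> + 1 \<and> x = y then 1 else 0)"
  using assms by (auto simp: weyr_mat_def append_rows_def)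

text \<open>Together with its mirror image, this evaluates products with the rows and columns of
  \<open>weyr_mat\<close>, each of which is zero or has a single one.\<close>

lemma scalar_prod_unit_left:
  fixes v w :: "'a::semiring_1 vec"
  assumes "j < dim_vec w" "\<And>i. i < dim_vec w \<Longrightarrow> v $ i = (if i = j then 1 else 0)"
  shows "v \<bullet> w = w $ j"
proof -
  have "v \<bullet> w = (\<Sum>i\<in>{0..<dim_vec w}. if i = j then w $ i else 0)"
    unfolding scalar_prod_def using assms(2) by (intro sum.cong) auto
  with assms(1) show ?thesis by simp
qed

lemma scalar_prod_unit_right:
  fixes v w :: "'a::semiring_1 vec"
  assumes "j < dim_vec w" "\<And>i. i < dim_vec w \<Longrightarrow> w $ i = (if i = j then 1 else 0)"
  shows "v \<bullet> w = v $ j"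
proof -
  have "v \<bullet> w = (\<Sum>i\<in>{0..<dim_vec w}. if i = j then v $ i else 0)"
    unfolding scalar_prod_def using assms(2) by (intro sum.cong) auto
  with assms(1) show ?thesis by simp
qed

text \<open>The row of \<open>weyr_mat\<close> at position \<open>\<alpha>\<close> of chain
  \<open>x\<close> has its one at position \<open>\<alpha> + 1\<close> of the same chain, and is
  zero when the chain ends at \<open>\<alpha>\<close>.\<close>

lemma weyr_mat_mult_left:
  fixes A :: "'a::semiring_1 mat"
  assumes A: "A \<in> carrier_mat (sum r {1..K}) (sum r {1..K})"
    and mono: "\<And>\<alpha>. 1 \<le> \<alpha> \<Longrightarrow> r (\<alpha> + 1) \<le> r \<alpha>"
    and \<alpha>: "1 \<le> \<alpha>" "\<alpha> \<le> K" "x < r \<alpha>" and j: "j < sum r {1..K}"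
  shows "(weyr_mat K r * A) $$ (block_idx r \<alpha> x, j) =
    (if \<alpha> < K \<and> x < r (\<alpha> + 1) then A $$ (block_idx r (\<alpha> + 1) x, j) else 0)"
proof -
  let ?W = "weyr_mat K r :: 'a mat"
  have W: "?W \<in> carrier_mat (sum r {1..K}) (sum r {1..K})" by simp
  have \<alpha>': "block_idx r \<alpha> x < sum r {1..K}" using \<alpha> by (rule block_idx_less)
  have entry: "?W $$ (block_idx r \<alpha> x, i) =
      (if \<alpha> < K \<and> x < r (\<alpha> + 1) \<and> i = block_idx r (\<alpha> + 1) x then 1 else 0)"
    if "i < sum r {1..K}" for i
  proof -
    from that obtain \<beta> y where \<beta>: "1 \<le> \<beta>" "\<beta> \<le> K" "y < r \<beta>" and i: "i = block_idx r \<beta> y"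
      by (elim block_idx_cases)
    \<comment> \<open>Both indices decode uniquely, so they agree exactly when block and offset
      agree.\<close>
    have "i = block_idx r (\<alpha> + 1) x \<longleftrightarrow> \<beta> = \<alpha> + 1 \<and> y = x" if "x < r (\<alpha> + 1)"
      using block_num_idx[of \<beta> y r] block_num_idx[of "\<alpha> + 1" x r]
        block_off_idx[of \<beta> y r] block_off_idx[of "\<alpha> + 1" x r] \<beta> i that
      by (metis le_add2)
    then show ?thesis
      using weyr_mat_block_idx[OF mono[OF \<alpha>(1)] \<alpha> \<beta>] \<alpha> \<beta> i by auto
  qed
  have "(?W * A) $$ (block_idx r \<alpha> x, j) = row ?W (block_idx r \<alpha> x) \<bullet> col A j"
    using A W \<alpha>' j by (intro index_mult_mat) auto
  also have "\<dots> = (if \<alpha> < K \<and> x < r (\<alpha> + 1) then A $$ (block_idx r (\<alpha> + 1) x, j) else 0)"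
  proof (cases "\<alpha> < K \<and> x < r (\<alpha> + 1)")
    case True
    with block_idx_less[of "\<alpha> + 1" K x r] have "block_idx r (\<alpha> + 1) x < sum r {1..K}" by simp
    with True A W \<alpha>' j show ?thesis
      by (subst scalar_prod_unit_left[of "block_idx r (\<alpha> + 1) x"]) (auto simp: entry)
  next
    case False
    with A W \<alpha>' j show ?thesis by (auto simp: scalar_prod_def entry)
  qed
  finally show ?thesis .
qed

text \<open>Dually, the column at position \<open>\<beta>\<close> of chain \<open>y\<close> has its
  one at position \<open>\<beta> - 1\<close>, and is zero at the start of the chain.\<close>

lemma weyr_mat_mult_right:
  fixes A :: "'a::semiring_1 mat"
  assumes A: "A \<in> carrier_mat (sum r {1..K}) (sum r {1..K})"
    and mono: "\<And>\<alpha>. 1 \<le> \<alpha> \<Longrightarrow> r (\<alpha> + 1) \<le> r \<alpha>"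
    and \<beta>: "1 \<le> \<beta>" "\<beta> \<le> K" "y < r \<beta>" and j: "j < sum r {1..K}"
  shows "(A * weyr_mat K r) $$ (j, block_idx r \<beta> y) =
    (if 2 \<le> \<beta> then A $$ (j, block_idx r (\<beta> - 1) y) else 0)"
proof -
  let ?W = "weyr_mat K r :: 'a mat"
  have W: "?W \<in> carrier_mat (sum r {1..K}) (sum r {1..K})" by simp
  have \<beta>': "block_idx r \<beta> y < sum r {1..K}" using \<beta> by (rule block_idx_less)
  \<comment> \<open>A chain present at position \<open>\<beta>\<close> is present at
    \<open>\<beta> - 1\<close>, because the block sizes do not increase.\<close>
  have pred: "1 \<le> \<beta> - 1" "\<beta> - 1 \<le> K" "y < r (\<beta> - 1)" if "2 \<le> \<beta>"
    using mono[of "\<beta> - 1"] \<beta> that by (auto simp: le_diff_conv2)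
  have entry: "?W $$ (i, block_idx r \<beta> y) =
      (if 2 \<le> \<beta> \<and> i = block_idx r (\<beta> - 1) y then 1 else 0)"
    if "i < sum r {1..K}" for i
  proof -
    from that obtain \<alpha> x where \<alpha>: "1 \<le> \<alpha>" "\<alpha> \<le> K" "x < r \<alpha>" and i: "i = block_idx r \<alpha> x"
      by (elim block_idx_cases)
    have "i = block_idx r (\<beta> - 1) y \<longleftrightarrow> \<beta> - 1 = \<alpha> \<and> y = x" if "2 \<le> \<beta>"
      using block_num_idx[of \<alpha> x r] block_num_idx[of "\<beta> - 1" y r]
        block_off_idx[of \<alpha> x r] block_off_idx[of "\<beta> - 1" y r] \<alpha> i pred[OF that]
      by metis
    then have "\<beta> = \<alpha> + 1 \<and> x = y \<longleftrightarrow> 2 \<le> \<beta> \<and> i = block_idx r (\<beta> - 1) y"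
      using \<alpha>(1) by (cases "2 \<le> \<beta>") auto
    then show ?thesis
      using weyr_mat_block_idx[OF mono[OF \<alpha>(1)] \<alpha> \<beta>] i by simp
  qed
  have "(A * ?W) $$ (j, block_idx r \<beta> y) = row A j \<bullet> col ?W (block_idx r \<beta> y)"
    using A W \<beta>' j by (intro index_mult_mat) auto
  also have "\<dots> = (if 2 \<le> \<beta> then A $$ (j, block_idx r (\<beta> - 1) y) else 0)"
  proof (cases "2 \<le> \<beta>")
    case True
    with block_idx_less[of "\<beta> - 1" K y r] pred have "block_idx r (\<beta> - 1) y < sum r {1..K}" by simp
    with True A W \<beta>' j show ?thesis
      by (subst scalar_prod_unit_right[of "block_idx r (\<beta> - 1) y"]) (auto simp: entry)
  next
    case False
    with A W \<beta>' j show ?thesis by (auto simp: scalar_prod_def entry)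
  qed
  finally show ?thesis .
qed

text \<open>Assumption \<open>h\<close> makes \<open>r\<close> the conjugate partition of the chain
  lengths: \<open>r \<alpha>\<close> counts the chains of length at least \<open>\<alpha>\<close>.
  Commuting then splits into one intertwining problem for each pair of chains.\<close>

lemma commute_weyr_mat_iff:
  fixes A :: "'a::semiring_1 mat"
  assumes A: "A \<in> carrier_mat (sum r {1..K}) (sum r {1..K})"
    and h: "\<And>\<alpha> x. 1 \<le> \<alpha> \<Longrightarrow> x < r \<alpha> \<longleftrightarrow> x < n \<and> \<alpha> \<le> h x"
    and hK: "\<And>x. x < n \<Longrightarrow> 1 \<le> h x \<and> h x \<le> K"
  shows "A * weyr_mat K r = weyr_mat K r * A \<longleftrightarrow>
    (\<forall>x<n. \<forall>y<n.
      (\<forall>\<alpha>\<in>{1..h x}. \<forall>\<beta>\<in>{1..h y}. A $$ (block_idx r \<alpha> x, block_idx r \<beta> y) =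
        (if \<alpha> \<le> \<beta> then A $$ (block_idx r 1 x, block_idx r (\<beta> - \<alpha> + 1) y) else 0)) \<and>
      (\<forall>\<gamma>. h x + \<gamma> < h y \<longrightarrow> A $$ (block_idx r 1 x, block_idx r (\<gamma> + 1) y) = 0))"
proof -
  let ?W = "weyr_mat K r :: 'a mat" and ?N = "sum r {1..K}"
  have W: "?W \<in> carrier_mat ?N ?N" by simp
  \<comment> \<open>Otherwise the chain \<open>r \<alpha>\<close> would reach position
    \<open>\<alpha> + 1\<close>, hence \<open>\<alpha>\<close>, giving
    \<open>r \<alpha> < r \<alpha>\<close>.\<close>
  have mono: "r (\<alpha> + 1) \<le> r \<alpha>" if "1 \<le> \<alpha>" for \<alpha>
    using h[of \<alpha> "r \<alpha>"] h[of "\<alpha> + 1" "r \<alpha>"] that by (meson Suc_leD leI le_add2 less_irrefl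
        Suc_eq_plus1 le_trans le_add1)
  have "A * ?W = ?W * A \<longleftrightarrow> (\<forall>\<alpha>\<in>{1..K}. \<forall>\<beta>\<in>{1..K}. \<forall>x<r \<alpha>. \<forall>y<r \<beta>.
      (A * ?W) $$ (block_idx r \<alpha> x, block_idx r \<beta> y) =
      (?W * A) $$ (block_idx r \<alpha> x, block_idx r \<beta> y))"
    using A W by (intro eq_mat_block_iff mult_carrier_mat)
  also have "\<dots> \<longleftrightarrow> (\<forall>\<alpha>\<in>{1..K}. \<forall>\<beta>\<in>{1..K}. \<forall>x<r \<alpha>. \<forall>y<r \<beta>.
      (if 2 \<le> \<beta> then A $$ (block_idx r \<alpha> x, block_idx r (\<beta> - 1) y) else 0) =
      (if \<alpha> < h x then A $$ (block_idx r (\<alpha> + 1) x, block_idx r \<beta> y) else 0))"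
  proof (intro ball_cong refl all_cong)
    fix \<alpha> \<beta> x y assume \<alpha>: "\<alpha> \<in> {1..K}" and \<beta>: "\<beta> \<in> {1..K}" and x: "x < r \<alpha>" and y: "y < r \<beta>"
    have "\<alpha> < K \<and> x < r (\<alpha> + 1) \<longleftrightarrow> \<alpha> < h x"
      using h[of \<alpha> x] h[of "\<alpha> + 1" x] \<alpha> x hK[of x] by auto
    then show "(A * ?W) $$ (block_idx r \<alpha> x, block_idx r \<beta> y) =
        (?W * A) $$ (block_idx r \<alpha> x, block_idx r \<beta> y) \<longleftrightarrow>
      (if 2 \<le> \<beta> then A $$ (block_idx r \<alpha> x, block_idx r (\<beta> - 1) y) else 0) =
      (if \<alpha> < h x then A $$ (block_idx r (\<alpha> + 1) x, block_idx r \<beta> y) else 0)"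
      using weyr_mat_mult_left[OF A mono, of \<alpha> x "block_idx r \<beta> y"]
        weyr_mat_mult_right[OF A mono, of \<beta> y "block_idx r \<alpha> x"] \<alpha> \<beta> x y
        block_idx_less[of \<alpha> K x r] block_idx_less[of \<beta> K y r] by simp
  qed
  \<comment> \<open>The same pairs (position, chain), now listed chain by chain instead of position
    by position.\<close>
  also have "\<dots> \<longleftrightarrow> (\<forall>x<n. \<forall>y<n. \<forall>\<alpha>\<in>{1..h x}. \<forall>\<beta>\<in>{1..h y}.
      (if 2 \<le> \<beta> then A $$ (block_idx r \<alpha> x, block_idx r (\<beta> - 1) y) else 0) =
      (if \<alpha> < h x then A $$ (block_idx r (\<alpha> + 1) x, block_idx r \<beta> y) else 0))"
    (is "?l \<longleftrightarrow> ?r")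
  proof
    assume ?l
    show ?r
    proof (intro allI impI ballI)
      fix x y \<alpha> \<beta> assume "x < n" "y < n" "\<alpha> \<in> {1..h x}" "\<beta> \<in> {1..h y}"
      then have "\<alpha> \<in> {1..K}" "\<beta> \<in> {1..K}" "x < r \<alpha>" "y < r \<beta>"
        using h hK[of x] hK[of y] by auto
      with \<open>?l\<close> show "(if 2 \<le> \<beta> then A $$ (block_idx r \<alpha> x, block_idx r (\<beta> - 1) y) else 0) =
          (if \<alpha> < h x then A $$ (block_idx r (\<alpha> + 1) x, block_idx r \<beta> y) else 0)" by blast
    qed
  next
    assume ?r
    show ?l
    proof (intro allI impI ballI)
      fix x y \<alpha> \<beta> assume "\<alpha> \<in> {1..K}" "\<beta> \<in> {1..K}" "x < r \<alpha>" "y < r \<beta>"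
      then have "x < n" "y < n" "\<alpha> \<in> {1..h x}" "\<beta> \<in> {1..h y}" using h by auto
      with \<open>?r\<close> show "(if 2 \<le> \<beta> then A $$ (block_idx r \<alpha> x, block_idx r (\<beta> - 1) y) else 0) =
          (if \<alpha> < h x then A $$ (block_idx r (\<alpha> + 1) x, block_idx r \<beta> y) else 0)" by blast
    qed
  qed
  also have "\<dots> \<longleftrightarrow> (\<forall>x<n. \<forall>y<n.
      (\<forall>\<alpha>\<in>{1..h x}. \<forall>\<beta>\<in>{1..h y}. A $$ (block_idx r \<alpha> x, block_idx r \<beta> y) =
        (if \<alpha> \<le> \<beta> then A $$ (block_idx r 1 x, block_idx r (\<beta> - \<alpha> + 1) y) else 0)) \<and>
      (\<forall>\<gamma>. h x + \<gamma> < h y \<longrightarrow> A $$ (block_idx r 1 x, block_idx r (\<gamma> + 1) y) = 0))"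
    using jordan_block_intertwiner[where a = "\<lambda>\<alpha> \<beta>. A $$ (block_idx r \<alpha> x, block_idx r \<beta> y)" for x y]
      hK by simp
  finally show ?thesis .
qed

section \<open>Counting Jordan blocks and their sizes\<close>

text \<open>Applied to the \<open>s\<close> with \<open>k s \<ge> \<alpha>\<close>: since the sizes
  decrease, their number alone determines which \<open>s\<close> they are.\<close>

lemma down_closed_eq_atLeastAtMost_card:
  fixes D :: "nat set"
  assumes "D \<subseteq> {1..t}" "\<And>s s'. s \<in> D \<Longrightarrow> 1 \<le> s' \<Longrightarrow> s' \<le> s \<Longrightarrow> s' \<in> D"
  shows "D = {1..card D}"
proof (cases "D = {}")
  case False
  have "finite D" using assms(1) finite_subset by blast
  with False have "Max D \<in> D" by simp
  have "D = {1..Max D}"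
  proof
    show "D \<subseteq> {1..Max D}" using assms(1) \<open>finite D\<close> by auto
    show "{1..Max D} \<subseteq> D" using assms(2)[OF \<open>Max D \<in> D\<close>] by (meson atLeastAtMost_iff subsetI)
  qed
  moreover from this have "card D = Max D" using card_atLeastAtMost[of 1 "Max D"] by simp
  ultimately show ?thesis by simp
qed simp

lemma jordan_blocks_replicate:
  fixes J :: "'a::field mat"
  assumes "\<And>s. s \<in> {1..t} \<Longrightarrow> 0 < k s"
    and "J = jordan_matrix (concat (map (\<lambda>s. replicate (p s) (k s, 0)) [1..<t+1]))"
  shows "jordan_blocks J = concat (map (\<lambda>s. replicate (p s) (k s, 0)) [1..<t+1])"
  unfolding assms(2) using assms(1)
  by (intro jordan_blocks_jordan_matrix) (force simp del: upt_Suc)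

section \<open>The commutant of the Weyr form\<close>

theorem theorem3:
  fixes t :: nat and k p :: "nat \<Rightarrow> nat" and J W :: "'a::field mat"
    and m r :: "nat \<Rightarrow> nat"
  assumes "1 \<le> t"
    and "\<And>s. 1 \<le> s \<Longrightarrow> s < t \<Longrightarrow> k (s + 1) < k s"
    and "0 < k t"
    and "\<And>s. 1 \<le> s \<Longrightarrow> s \<le> t \<Longrightarrow> 1 \<le> p s"
    and "J = jordan_matrix (concat (map (\<lambda>s. replicate (p s) (k s, 0)) [1..<t+1]))"
    and "W = weyr_form J"
    and "m = num_sizes_ge J"
    and "r = num_blocks_ge J"
  shows "{A \<in> carrier_mat (dim_row W) (dim_col W). A * W = W * A} =
    {partitioned_mat (k 1) (k 1) r r
       (\<lambda>\<alpha> \<beta>. if \<alpha> \<le> \<beta> then partitioned_mat (m \<alpha>) (m \<beta>) p p (\<lambda>i j. S i j (\<beta> - \<alpha>))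
              else 0\<^sub>m (r \<alpha>) (r \<beta>)) | S :: nat \<Rightarrow> nat \<Rightarrow> nat \<Rightarrow> 'a mat.
     \<forall>i\<in>{1..t}. \<forall>j\<in>{1..t}. \<forall>\<gamma><k 1.
       S i j \<gamma> \<in> carrier_mat (p i) (p j) \<and>
       (int (k j) - int (k i) > int \<gamma> \<longrightarrow> S i j \<gamma> = 0\<^sub>m (p i) (p j))}"
proof -
  let ?L = "concat (map (\<lambda>s. replicate (p s) (k s, 0)) [1..<t+1]) :: (nat \<times> 'a) list"
  \<comment> \<open>The \<open>n\<close> chains are numbered from 0 in order of decreasing length;
    \<open>p\<close> partitions them into groups of equal length, so \<open>block_num p x\<close> is
    the group of chain \<open>x\<close> and \<open>h x\<close> its length.\<close>
  define h where "h x = k (block_num p x)" for x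
  define n where "n = sum p {1..t}"
  have k_less: "k s' < k s" if "1 \<le> s" "s < s'" "s' \<le> t" for s s'
    using that(2,3)
  proof (induction s')
    case (Suc s')
    then have "k (Suc s') < k s'" using assms(2)[of s'] that(1) by (simp add: Suc_eq_plus1)
    with Suc show ?case by (cases "s = s'") auto
  qed simp
  have k_pos: "0 < k s" if "s \<in> {1..t}" for s
    using k_less[of s t] assms(3) that by (cases "s = t") auto
  have k_le: "k s \<le> k 1" if "s \<in> {1..t}" for s
    using k_less[of 1 s] that by (cases "s = 1") auto
  have blocks: "jordan_blocks J = ?L"
    by (rule jordan_blocks_replicate[OF _ assms(5)]) (rule k_pos)
  have sizes: "fst ` set (jordan_blocks J) = k ` {1..t}"
  proof -
    \<comment> \<open>As \<open>p s \<ge> 1\<close>, every size \<open>k s\<close> really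
      occurs.\<close>
    have "set (replicate (p s) (k s, 0 :: 'a)) = {(k s, 0)}" if "s \<in> {1..t}" for s
      using assms(4)[of s] that by (simp add: set_replicate_conv_if)
    moreover have "set [1..<t+1] = {1..t}" by auto
    ultimately show ?thesis unfolding blocks
      by (simp add: image_UN image_image UNION_singleton_eq_range del: upt_Suc)
  qed
  have inj: "inj_on k {1..t}"
  proof (rule linorder_inj_onI')
    fix s s' assume "s \<in> {1..t}" "s' \<in> {1..t}" "s < s'"
    then show "k s \<noteq> k s'" using k_less[of s s'] by simp
  qed
  have m_set: "{s \<in> {1..t}. \<alpha> \<le> k s} = {1..m \<alpha>}" for \<alpha>
  proof -
    have "{n \<in> k ` {1..t}. \<alpha> \<le> n} = k ` {s \<in> {1..t}. \<alpha> \<le> k s}" by auto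
    moreover have "inj_on k {s \<in> {1..t}. \<alpha> \<le> k s}" using inj by (rule inj_on_subset) auto
    ultimately have "m \<alpha> = card {s \<in> {1..t}. \<alpha> \<le> k s}"
      by (simp add: assms(7) num_sizes_ge_def sizes card_image)
    moreover have "{s \<in> {1..t}. \<alpha> \<le> k s} = {1..card {s \<in> {1..t}. \<alpha> \<le> k s}}"
    proof (rule down_closed_eq_atLeastAtMost_card)
      fix s s' assume "s \<in> {s \<in> {1..t}. \<alpha> \<le> k s}" "1 \<le> s'" "s' \<le> s"
      then show "s' \<in> {s \<in> {1..t}. \<alpha> \<le> k s}"
        using k_less[of s' s] by (cases "s' = s") auto
    qed auto
    ultimately show ?thesis by simp
  qed
  have r_eq: "r \<alpha> = sum p {1..m \<alpha>}" for \<alpha>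
  proof -
    have "r \<alpha> = (\<Sum>s\<leftarrow>[1..<t+1]. if \<alpha> \<le> k s then p s else 0)"
      by (simp add: assms(8) num_blocks_ge_def blocks filter_concat length_concat comp_def
          filter_replicate if_distrib cong: if_cong del: upt_Suc)
    also have "\<dots> = (\<Sum>s\<in>{1..t}. if \<alpha> \<le> k s then p s else 0)"
      by (subst sum_list_distinct_conv_sum_set)
        (auto simp: atLeastLessThanSuc_atLeastAtMost Suc_eq_plus1[symmetric] simp del: upt_Suc)
    also have "\<dots> = sum p {s \<in> {1..t}. \<alpha> \<le> k s}" by (rule sum.inter_filter[symmetric]) simp
    finally show ?thesis unfolding m_set .
  qed
  have num: "block_num p x \<in> {1..t}" if "x < n" for x
    using that block_num_ge_1[of x p t] block_num_le_iff[of x p t t] by (simp add: n_def)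
  note off = block_off_less[of _ p t, folded n_def] block_idx_num_off[of _ p t, folded n_def]
  \<comment> \<open>The first \<open>r \<alpha>\<close> chains fill exactly the groups 1 to
    \<open>m \<alpha>\<close>, which are those of length at least \<open>\<alpha>\<close>.\<close>
  have h: "x < r \<alpha> \<longleftrightarrow> x < n \<and> \<alpha> \<le> h x" for \<alpha> x
  proof (cases "x < n")
    case True
    then have "x < r \<alpha> \<longleftrightarrow> block_num p x \<in> {1..m \<alpha>}"
      using num[of x] block_num_le_iff[of x p t "m \<alpha>"] by (simp add: r_eq n_def)
    with True num[of x] show ?thesis by (simp add: m_set[symmetric] h_def)
  next
    case False
    have "r \<alpha> \<le> n" unfolding r_eq n_def m_set[symmetric] by (rule sum_mono2) auto
    with False show ?thesis by simp
  qed
  have hK: "1 \<le> h x \<and> h x \<le> k 1" if "x < n" for x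
    using k_pos[OF num[OF that]] k_le[OF num[OF that]] by (simp add: h_def)
  have "Max (fst ` set (jordan_blocks J)) = k 1"
    unfolding sizes using assms(1) k_le by (intro Max_eqI) auto
  then have W: "W = weyr_mat (k 1) r"
    by (simp add: assms(6,8) weyr_form_def weyr_mat_def Let_def)
  define N where "N = sum r {1..k 1}"
  have dims: "dim_row W = N" "dim_col W = N"
    by (simp_all add: W N_def)
  let ?F = "\<lambda>S :: nat \<Rightarrow> nat \<Rightarrow> nat \<Rightarrow> 'a mat. partitioned_mat (k 1) (k 1) r r
       (\<lambda>\<alpha> \<beta>. if \<alpha> \<le> \<beta> then partitioned_mat (m \<alpha>) (m \<beta>) p p (\<lambda>i j. S i j (\<beta> - \<alpha>))
              else 0\<^sub>m (r \<alpha>) (r \<beta>))"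
  let ?P = "\<lambda>S :: nat \<Rightarrow> nat \<Rightarrow> nat \<Rightarrow> 'a mat. \<forall>i\<in>{1..t}. \<forall>j\<in>{1..t}. \<forall>\<gamma><k 1.
       S i j \<gamma> \<in> carrier_mat (p i) (p j) \<and>
       (int (k j) - int (k i) > int \<gamma> \<longrightarrow> S i j \<gamma> = 0\<^sub>m (p i) (p j))"
  have F_carrier: "?F S \<in> carrier_mat N N" for S
    unfolding N_def by simp
  \<comment> \<open>The inner partitions stop at \<open>m \<alpha>\<close> and
    \<open>m \<beta>\<close>, but decoding by \<open>p\<close> does not depend on where they stop.
    Hence the entry depends on the positions only through the diagonal
    \<open>\<beta> - \<alpha>\<close>.\<close>
  have F_entry: "?F S $$ (block_idx r \<alpha> x, block_idx r \<beta> y) =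
      (if \<alpha> \<le> \<beta> then S (block_num p x) (block_num p y) (\<beta> - \<alpha>) $$ (block_off p x, block_off p y)
       else 0)"
    if "x < n" "y < n" "\<alpha> \<in> {1..h x}" "\<beta> \<in> {1..h y}" for S \<alpha> \<beta> x y
  proof -
    have "x < r \<alpha>" "y < r \<beta>" "\<alpha> \<le> k 1" "\<beta> \<le> k 1"
      using that h hK[of x] hK[of y] by auto
    moreover from this have "partitioned_mat (m \<alpha>) (m \<beta>) p p B $$ (x, y) =
        B (block_num p x) (block_num p y) $$ (block_off p x, block_off p y)"
      for B :: "nat \<Rightarrow> nat \<Rightarrow> 'a mat"
      by (simp add: partitioned_mat_def r_eq)
    ultimately show ?thesis using that by simp
  qed
  have commute_iff: "A * W = W * A \<longleftrightarrow> (\<forall>x<n. \<forall>y<n.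
      (\<forall>\<alpha>\<in>{1..h x}. \<forall>\<beta>\<in>{1..h y}. A $$ (block_idx r \<alpha> x, block_idx r \<beta> y) =
        (if \<alpha> \<le> \<beta> then A $$ (block_idx r 1 x, block_idx r (\<beta> - \<alpha> + 1) y) else 0)) \<and>
      (\<forall>\<gamma>. h x + \<gamma> < h y \<longrightarrow> A $$ (block_idx r 1 x, block_idx r (\<gamma> + 1) y) = 0))"
    if "A \<in> carrier_mat N N" for A
    unfolding W by (rule commute_weyr_mat_iff[OF that[unfolded N_def] h hK])
  have sub1: "\<exists>S. A = ?F S \<and> ?P S" if A: "A \<in> carrier_mat N N" and "A * W = W * A" for A
  proof -
    \<comment> \<open>The witness is read off from the first block row of \<open>A\<close>. For
      \<open>\<gamma> \<ge> k j\<close> the chains of group \<open>j\<close> have no position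
      \<open>\<gamma> + 1\<close>, and the entry is set to 0.\<close>
    define S where "S i j \<gamma> = mat (p i) (p j) (\<lambda>(u, v). if \<gamma> < k j
      then A $$ (block_idx r 1 (block_idx p i u), block_idx r (\<gamma> + 1) (block_idx p j v)) else 0)"
      for i j \<gamma>
    note comm = iffD1[OF commute_iff[OF A] that(2), rule_format]
    have "A = ?F S"
    proof (subst eq_mat_block_iff[OF A[unfolded N_def] F_carrier[unfolded N_def]],
        intro ballI allI impI)
      fix \<alpha> \<beta> x y assume *: "\<alpha> \<in> {1..k 1}" "\<beta> \<in> {1..k 1}" "x < r \<alpha>" "y < r \<beta>"
      then have xy: "x < n" "y < n" "\<alpha> \<in> {1..h x}" "\<beta> \<in> {1..h y}" using h by auto
      \<comment> \<open>This selects the branch of \<open>S\<close> that reads from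
        \<open>A\<close>; strictness comes from \<open>\<alpha> \<ge> 1\<close>.\<close>
      have "\<beta> - \<alpha> < k (block_num p y)" using xy by (auto simp: h_def)
      then show "A $$ (block_idx r \<alpha> x, block_idx r \<beta> y) =
          ?F S $$ (block_idx r \<alpha> x, block_idx r \<beta> y)"
        using conjunct1[OF comm, rule_format, OF xy] xy(1,2)
        by (simp add: F_entry[OF xy] S_def off)
    qed
    moreover have "?P S"
    proof (intro ballI allI impI conjI)
      fix i j \<gamma> assume i: "i \<in> {1..t}" and j: "j \<in> {1..t}"
      show "S i j \<gamma> \<in> carrier_mat (p i) (p j)" by (simp add: S_def)
      assume \<gamma>: "int (k j) - int (k i) > int \<gamma>"
      show "S i j \<gamma> = 0\<^sub>m (p i) (p j)"
      proof (rule eq_matI)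
        fix u v assume "u < dim_row (0\<^sub>m (p i) (p j) :: 'a mat)"
          "v < dim_col (0\<^sub>m (p i) (p j) :: 'a mat)"
        then have uv: "u < p i" "v < p j" by auto
        have "block_idx p i u < n" "block_idx p j v < n"
          unfolding n_def using i j uv by (auto intro: block_idx_less)
        \<comment> \<open>The condition on sizes, restated for chain \<open>u\<close> of group
          \<open>i\<close> and chain \<open>v\<close> of group \<open>j\<close>.\<close>
        moreover have "h (block_idx p i u) + \<gamma> < h (block_idx p j v)"
          using i j uv \<gamma> by (simp add: h_def)
        ultimately show "S i j \<gamma> $$ (u, v) = 0\<^sub>m (p i) (p j) $$ (u, v)"
          using conjunct2[OF comm, rule_format, of "block_idx p i u" "block_idx p j v" \<gamma>] uv
          by (simp add: S_def)
      qed (auto simp: S_def)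
    qed
    ultimately show ?thesis by blast
  qed
  have sub2: "?F S * W = W * ?F S" if S: "?P S" for S
  proof (subst commute_iff[OF F_carrier], intro allI impI conjI ballI)
    fix x y assume xy: "x < n" "y < n"
    have x1: "1 \<in> {1..h x}" using hK[OF xy(1)] by simp
    {
      fix \<alpha> \<beta> assume ab: "\<alpha> \<in> {1..h x}" "\<beta> \<in> {1..h y}"
      \<comment> \<open>Both entries compared below lie on the diagonal
        \<open>\<beta> - \<alpha>\<close> and so are the same entry of \<open>S\<close>. If
        \<open>\<alpha> > \<beta>\<close>, truncated subtraction gives column 1, still in
        range.\<close>
      then have "\<beta> - \<alpha> + 1 \<in> {1..h y}" by auto
      from F_entry[OF xy ab, of S] F_entry[OF xy x1 this, of S]
      show "?F S $$ (block_idx r \<alpha> x, block_idx r \<beta> y) =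
        (if \<alpha> \<le> \<beta> then ?F S $$ (block_idx r 1 x, block_idx r (\<beta> - \<alpha> + 1) y) else 0)"
        by (simp del: Nat.add_diff_assoc2)
    next
      fix \<gamma> assume \<gamma>: "h x + \<gamma> < h y"
      then have "\<gamma> + 1 \<in> {1..h y}" "\<gamma> < k 1" using hK[OF xy(2)] by auto
      moreover have "S (block_num p x) (block_num p y) \<gamma> = 0\<^sub>m (p (block_num p x)) (p (block_num p y))"
        using S num[OF xy(1)] num[OF xy(2)] \<gamma> \<open>\<gamma> < k 1\<close> by (auto simp: h_def)
      ultimately show "?F S $$ (block_idx r 1 x, block_idx r (\<gamma> + 1) y) = 0"
        using F_entry[OF xy x1, of "\<gamma> + 1" S] xy by (simp add: off)
    }
  qed
  show ?thesis
    unfolding dims using sub1 sub2 F_carrier by (intro equalityI subsetI) (blast, auto)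
qed

end
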